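(* Suppose the inverse robust optimization problem $(\mathcal{P}_{\mathrm{IROP}})$ has a maximizer $(x^*,W^* )\in X\times\mathcal{W}$, that $f(x^*,\cdot)$ and $g(x^*,\cdot)$ are continuous functions of $u$, that the merit function $V:\mathcal{W}\to\mathbb{R}$ satisfies (B1) the restriction of $V$ to $\mathcal{K}(\mathcal{U})\cap\mathcal{W}$ is upper semi-continuous with respect to the topology induced by the Hausdorff metric, and (B2) $V(W_1)\le V(W_2)$ for all $W_1,W_2\in\mathcal{W}$ with $W_1\subseteq W_2$, and that the cover space satisfies $\tilde W^*:=\overline{W^*}\cap\mathcal{U}\in\mathcal{W}$, where $\overline{W^*}$ denotes the closure of $W^*$. Then $(x^*,\tilde W^* )$ is also a maximizer of $(\mathcal{P}_{\mathrm{IROP}})$.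
   Context: Here $X\subseteq\mathbb{R}^n$, $\mathcal{U}\subseteq\mathbb{R}^m$ is the uncertainty set, $\mathcal{W}\subseteq 2^{\mathcal{U}}$ is the cover space, and $f,g$ are real-valued functions of $(x,u)$ with $x\in X$, $u\in\mathbb{R}^m$, such that $f(\cdot,u)$ and $g(\cdot,u)$ are continuous on $X$ for each fixed $u$. A nominal scenario $\bar u\in\mathcal{U}$ is fixed, and it is assumed that the nominal problem $f^*:=\min\{f(x,\bar u): x\in X,\ g(x,\bar u)\le 0\}$ has a feasible point and that $f^*$ is well defined. A budget $\epsilon\ge 0$ is fixed. The inverse robust optimization problem $(\mathcal{P}_{\mathrm{IROP}})$ is: maximize $V(W)$ over all $(x,W)\in X\times\mathcal{W}$ subject to $f(x,u)\le f^*+\epsilon$ for all $u\in W$, $\ g(x,u)\le 0$ for all $u\in W$, and $\bar u\in W$. A maximizer is a feasible pair attaining the maximal value of $V(W)$ among feasible pairs. $\mathcal{K}(\mathcal{U})$ denotes the set of all compact subsets of $\mathcal{U}$, with the Hausdorff metric (if the empty set is included it is treated as an isolated point). Closures are taken in $\mathbb{R}^m$. *)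

theory Defs
  imports "HOL-Analysis.Analysis"
begin

definition nominal_feasible ::
  "'x set \<Rightarrow> ('x \<Rightarrow> 'u \<Rightarrow> real) \<Rightarrow> 'u \<Rightarrow> 'x set" where
  "nominal_feasible X g ubar = {x \<in> X. g x ubar \<le> 0}"

text \<open>The nominal problem has a minimizer, so that its minimum \<open>f\<^sup>*\<close> is well defined.\<close>

definition nominal_solvable ::
  "'x set \<Rightarrow> ('x \<Rightarrow> 'u \<Rightarrow> real) \<Rightarrow> ('x \<Rightarrow> 'u \<Rightarrow> real) \<Rightarrow> 'u \<Rightarrow> bool" where
  "nominal_solvable X f g ubar \<longleftrightarrow>
     (\<exists>x0 \<in> nominal_feasible X g ubar. \<forall>x \<in> nominal_feasible X g ubar. f x0 ubar \<le> f x ubar)"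

text \<open>\<open>LEAST\<close> is the minimum of the set of objective values; it is meaningful only
  under \<^const>\<open>nominal_solvable\<close>.\<close>

definition nominal_value ::
  "'x set \<Rightarrow> ('x \<Rightarrow> 'u \<Rightarrow> real) \<Rightarrow> ('x \<Rightarrow> 'u \<Rightarrow> real) \<Rightarrow> 'u \<Rightarrow> real" where
  "nominal_value X f g ubar = (LEAST v. v \<in> (\<lambda>x. f x ubar) ` nominal_feasible X g ubar)"

definition irop_feasible ::
  "'x set \<Rightarrow> 'u set set \<Rightarrow> ('x \<Rightarrow> 'u \<Rightarrow> real) \<Rightarrow> ('x \<Rightarrow> 'u \<Rightarrow> real) \<Rightarrow> 'u \<Rightarrow> real \<Rightarrow> ('x \<times> 'u set) set" where
  "irop_feasible X \<W> f g ubar \<epsilon> =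
     {(x, W). x \<in> X \<and> W \<in> \<W> \<and>
        (\<forall>u\<in>W. f x u \<le> nominal_value X f g ubar + \<epsilon>) \<and>
        (\<forall>u\<in>W. g x u \<le> 0) \<and>
        ubar \<in> W}"

definition irop_maximizer ::
  "'x set \<Rightarrow> 'u set set \<Rightarrow> ('x \<Rightarrow> 'u \<Rightarrow> real) \<Rightarrow> ('x \<Rightarrow> 'u \<Rightarrow> real) \<Rightarrow> 'u \<Rightarrow> real \<Rightarrow>
    ('u set \<Rightarrow> real) \<Rightarrow> 'x \<times> 'u set \<Rightarrow> bool" where
  "irop_maximizer X \<W> f g ubar \<epsilon> V p \<longleftrightarrow>
     p \<in> irop_feasible X \<W> f g ubar \<epsilon> \<and>
     (\<forall>q \<in> irop_feasible X \<W> f g ubar \<epsilon>. V (snd q) \<le> V (snd p))"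

definition compact_subsets :: "'u::topological_space set \<Rightarrow> 'u set set" where
  "compact_subsets U = {K. K \<subseteq> U \<and> compact K}"

text \<open>The Hausdorff distance, with values in \<open>[0, \<infinity>]\<close>. On nonempty compact sets it is finite and is
  the usual Hausdorff metric. Since an infimum over \<open>{}\<close> is \<open>\<infinity>\<close> and a supremum over \<open>{}\<close> is \<open>0\<close>,
  the empty set has distance \<open>\<infinity>\<close> to every nonempty set, so it is isolated in the
  induced topology.\<close>

definition hausdorff_edist :: "'u::metric_space set \<Rightarrow> 'u set \<Rightarrow> ennreal" where
  "hausdorff_edist A B =
     max (SUP a\<in>A. INF b\<in>B. ennreal (dist a b)) (SUP b\<in>B. INF a\<in>A. ennreal (dist a b))"

definition hausdorff_topology :: "'u::metric_space set \<Rightarrow> 'u set topology" where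
  "hausdorff_topology U = topology (\<lambda>S. S \<subseteq> compact_subsets U \<and>
     (\<forall>A\<in>S. \<exists>e>0. \<forall>B\<in>compact_subsets U. hausdorff_edist A B < e \<longrightarrow> B \<in> S))"

lemma openin_hausdorff_topology:
  "openin (hausdorff_topology U) S \<longleftrightarrow> S \<subseteq> compact_subsets U \<and>
     (\<forall>A\<in>S. \<exists>e>0. \<forall>B\<in>compact_subsets U. hausdorff_edist A B < e \<longrightarrow> B \<in> S)"
proof -
  let ?L = "\<lambda>S. S \<subseteq> compact_subsets U \<and>
     (\<forall>A\<in>S. \<exists>e>0. \<forall>B\<in>compact_subsets U. hausdorff_edist A B < e \<longrightarrow> B \<in> S)"
  have "?L (S \<inter> T)" if S: "?L S" and T: "?L T" for S T
  proof (intro conjI ballI)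
    show "S \<inter> T \<subseteq> compact_subsets U" using S by blast
  next
    fix A assume A: "A \<in> S \<inter> T"
    obtain d where d: "d > 0" "\<forall>B\<in>compact_subsets U. hausdorff_edist A B < d \<longrightarrow> B \<in> S"
      using S A by blast
    obtain e where e: "e > 0" "\<forall>B\<in>compact_subsets U. hausdorff_edist A B < e \<longrightarrow> B \<in> T"
      using T A by blast
    show "\<exists>e>0. \<forall>B\<in>compact_subsets U. hausdorff_edist A B < e \<longrightarrow> B \<in> S \<inter> T"
      using d e by (intro exI[of _ "min d e"]) auto
  qed
  moreover have "?L (\<Union>\<K>)" if "\<forall>K\<in>\<K>. ?L K" for \<K>
    using that by (meson UnionE UnionI Union_least)
  ultimately have "istopology ?L"
    unfolding istopology_def by blast
  then show ?thesis
    by (simp add: hausdorff_topology_def)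
qed

lemma topspace_hausdorff_topology [simp]:
  "topspace (hausdorff_topology U) = compact_subsets U"
proof -
  have "openin (hausdorff_topology U) (compact_subsets U)"
    unfolding openin_hausdorff_topology by (auto intro: exI[of _ 1])
  moreover have "topspace (hausdorff_topology U) \<subseteq> compact_subsets U"
    using openin_topspace openin_hausdorff_topology by blast
  ultimately show ?thesis
    by (simp add: openin_subset subset_antisym)
qed

definition upper_semicontinuous_map :: "'a topology \<Rightarrow> ('a \<Rightarrow> real) \<Rightarrow> bool" where
  "upper_semicontinuous_map T V \<longleftrightarrow> (\<forall>c. openin T {x \<in> topspace T. V x < c})"

end

theory Submission
  imports Defs
begin

text \<open>With \<open>xstar\<close> fixed, both robust constraints are weak inequalities on
  continuous functions of u, so each confines \<open>Wstar\<close> to a closed sublevel set. That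
  set then contains the whole closure (\<open>closure_le_const\<close>), and replacing
  \<open>Wstar\<close> by its closure within \<open>U\<close> preserves feasibility. By monotonicity
  (B2) the enlargement cannot lower the merit, and \<open>Wstar\<close> was already optimal, so the
  larger set is optimal too.\<close>

lemma closure_le_const:
  fixes h :: "'a::topological_space \<Rightarrow> 'b::linorder_topology"
  assumes "continuous_on UNIV h" and "\<And>u. u \<in> W \<Longrightarrow> h u \<le> c" and "u \<in> closure W"
  shows "h u \<le> c"
proof -
  have "closure W \<subseteq> {u. h u \<le> c}"
    using assms(1,2) by (intro closure_minimal closed_Collect_le) auto
  then show ?thesis
    using assms(3) by blast
qed

theorem lemma2p6:
  fixes X :: "(real ^ 'n) set"
    and U :: "(real ^ 'm) set"
    and \<W> :: "(real ^ 'm) set set"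
    and f g :: "real ^ 'n \<Rightarrow> real ^ 'm \<Rightarrow> real"
    and ubar :: "real ^ 'm"
    and \<epsilon> :: real
    and V :: "(real ^ 'm) set \<Rightarrow> real"
    and xstar :: "real ^ 'n"
    and Wstar :: "(real ^ 'm) set"
  assumes cover: "\<W> \<subseteq> Pow U"
    and cont_f: "\<And>u. continuous_on X (\<lambda>x. f x u)"
    and cont_g: "\<And>u. continuous_on X (\<lambda>x. g x u)"
    and nominal: "ubar \<in> U"
    and nominal_nonempty: "nominal_feasible X g ubar \<noteq> {}"
    and nominal_min: "nominal_solvable X f g ubar"
    and budget: "\<epsilon> \<ge> 0"
    and maximizer: "irop_maximizer X \<W> f g ubar \<epsilon> V (xstar, Wstar)"
    and cont_f_u: "continuous_on UNIV (\<lambda>u. f xstar u)"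
    and cont_g_u: "continuous_on UNIV (\<lambda>u. g xstar u)"
    and B1: "upper_semicontinuous_map (subtopology (hausdorff_topology U) \<W>) V"
    and B2: "\<And>W1 W2. W1 \<in> \<W> \<Longrightarrow> W2 \<in> \<W> \<Longrightarrow> W1 \<subseteq> W2 \<Longrightarrow> V W1 \<le> V W2"
    and closure_mem: "closure Wstar \<inter> U \<in> \<W>"
  shows "irop_maximizer X \<W> f g ubar \<epsilon> V (xstar, closure Wstar \<inter> U)"
proof -
  have feas: "(xstar, Wstar) \<in> irop_feasible X \<W> f g ubar \<epsilon>"
    and opt: "\<And>q. q \<in> irop_feasible X \<W> f g ubar \<epsilon> \<Longrightarrow> V (snd q) \<le> V Wstar"
    using maximizer by (auto simp: irop_maximizer_def)
  have Wstar: "xstar \<in> X" "Wstar \<in> \<W>" "ubar \<in> Wstar"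
    and f_le: "\<And>u. u \<in> Wstar \<Longrightarrow> f xstar u \<le> nominal_value X f g ubar + \<epsilon>"
    and g_le: "\<And>u. u \<in> Wstar \<Longrightarrow> g xstar u \<le> 0"
    using feas by (auto simp: irop_feasible_def)
  \<comment> \<open>Cutting the closure back to \<open>U\<close> loses no point of
    \<open>Wstar\<close>, since cover sets lie in \<open>U\<close>. This inclusion both keeps
    \<open>ubar\<close> in the new set and makes B2 applicable.\<close>
  have sub: "Wstar \<subseteq> closure Wstar \<inter> U"
    using cover Wstar(2) closure_subset by blast
  have "(xstar, closure Wstar \<inter> U) \<in> irop_feasible X \<W> f g ubar \<epsilon>"
    using Wstar sub closure_mem closure_le_const[OF cont_f_u f_le] closure_le_const[OF cont_g_u g_le]
    by (auto simp: irop_feasible_def)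
  moreover have "V Wstar \<le> V (closure Wstar \<inter> U)"
    using B2[OF Wstar(2) closure_mem sub] .
  \<comment> \<open>Every feasible pair has merit at most V \<open>Wstar\<close>, hence by
    transitivity at most that of the enlarged set.\<close>
  ultimately show ?thesis
    using opt by (force simp: irop_maximizer_def)
qed

end
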